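(* Let $A$ be an ordered commutative monoid with a generating pair $(g_+,g_-)$, and let $x,y\in A$ with $x\geq 0$ and $y\geq 0$. Then $$R^{\mathrm{reg}}_{\min}(x\to y)=0,\qquad R^{\mathrm{reg}}_{\max}(x\to y)=\inf_f\frac{f(x)}{f(y)},$$ where the infimum may be taken to range either over all functionals $f:A\to\mathbb{R}$ with $f(y)\neq0$, or over all extremal functionals $f:A\to\mathbb{R}$ with $f(y)\neq 0$.
   Context: $\mathbb{N}=\{0,1,2,\dots\}$. An ordered commutative monoid is a set $A$ with a partial order $\geq$ and a commutative monoid structure $(+,0)$ such that $x\geq y$ implies $x+z\geq y+z$; $nx$ denotes the $n$-fold sum. A functional on $A$ is a map $f:A\to\mathbb{R}$ with $x\geq y\Rightarrow f(x)\geq f(y)$, $f(x+y)=f(x)+f(y)$, $f(0)=0$. For functionals write $f\geq f'$ if $f-f'$ is a functional; $f$ is extremal if every functional $f'$ with $f\geq f'$ is of the form $f'=\lambda f$ with $\lambda\in\mathbb{R}_{\geq0}$. A generating pair is a pair $g_+,g_-\in A$ with $g_+\geq g_-$ such that for every $x\in A$ there is $n\in\mathbb{N}$ with $ng_+\geq x+ng_-$ and $ng_++x\geq ng_-$. A fraction $\tfrac mn$ means a pair $m,n\in\mathbb{N}$, not both zero, interpreted as an element of $[0,\infty]$ ($\tfrac m0=\infty$ for $m>0$). A number $r\in\mathbb{R}_{\geq0}\cup\{\infty\}$ is a regularized rate from $x$ to $y$ if for every $\varepsilon>0$ and every neighbourhood of $r$ in $[0,\infty]$ there exist a fraction $\tfrac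 mn$ in the neighbourhood and $k\in\mathbb{N}$ with $k\leq\varepsilon\max(m,n)$ and $nx+kg_+\geq my+kg_-$. This does not depend on the choice of generating pair. The set of regularized rates from $x$ to $y$ is a closed interval in $[0,\infty]$, with endpoints $R^{\mathrm{reg}}_{\min}(x\to y)\leq R^{\mathrm{reg}}_{\max}(x\to y)$. The infimum of the empty set is $\infty$. *)

theory Defs
  imports "HOL-Analysis.Analysis"
begin

text \<open>
  An ordered commutative monoid is a type of class \<^class>\<open>ordered_comm_monoid_add\<close>, whose
  order is partial and whose addition need not be cancellative.
\<close>

definition nfold :: "nat \<Rightarrow> 'a::comm_monoid_add \<Rightarrow> 'a" where
  "nfold n x = (\<Sum>i<n. x)"

definition functional :: "('a::ordered_comm_monoid_add \<Rightarrow> real) \<Rightarrow> bool" where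
  "functional f \<longleftrightarrow>
     (\<forall>x y. x \<ge> y \<longrightarrow> f x \<ge> f y) \<and> (\<forall>x y. f (x + y) = f x + f y) \<and> f 0 = 0"

text \<open>
  Functionals are compared by the relation below, which is stronger than the pointwise order:
  the difference has to be monotone as well.
\<close>

definition functional_ge ::
    "('a::ordered_comm_monoid_add \<Rightarrow> real) \<Rightarrow> ('a \<Rightarrow> real) \<Rightarrow> bool" where
  "functional_ge f f' \<longleftrightarrow> functional (\<lambda>x. f x - f' x)"

definition extremal_functional :: "('a::ordered_comm_monoid_add \<Rightarrow> real) \<Rightarrow> bool" where
  "extremal_functional f \<longleftrightarrow> functional f \<and>
     (\<forall>f'. functional f' \<and> functional_ge f f' \<longrightarrow> (\<exists>l::real. l \<ge> 0 \<and> f' = (\<lambda>x. l * f x)))"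

definition generating_pair :: "'a::ordered_comm_monoid_add \<Rightarrow> 'a \<Rightarrow> bool" where
  "generating_pair gp gm \<longleftrightarrow> gp \<ge> gm \<and>
     (\<forall>x. \<exists>n::nat. nfold n gp \<ge> x + nfold n gm \<and> nfold n gp + x \<ge> nfold n gm)"

text \<open>
  The interval $[0,\infty]$ is the type \<^typ>\<open>ennreal\<close>, in which division by zero gives
  $m/0 = \infty$ for $m > 0$. The pair $(0,0)$, for which division would yield 0, is excluded.
\<close>

definition regularized_rate ::
    "'a::ordered_comm_monoid_add \<Rightarrow> 'a \<Rightarrow> 'a \<Rightarrow> 'a \<Rightarrow> ennreal \<Rightarrow> bool" where
  "regularized_rate gp gm x y r \<longleftrightarrow>
     (\<forall>\<epsilon>::real. \<epsilon> > 0 \<longrightarrow> (\<forall>U. open U \<and> r \<in> U \<longrightarrow>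
        (\<exists>m n k :: nat. \<not> (m = 0 \<and> n = 0) \<and> of_nat m / of_nat n \<in> U \<and>
           real k \<le> \<epsilon> * real (max m n) \<and>
           nfold n x + nfold k gp \<ge> nfold m y + nfold k gm)))"

text \<open>The endpoints of the closed interval of regularized rates are its infimum and supremum.\<close>

definition R_reg_min :: "'a::ordered_comm_monoid_add \<Rightarrow> 'a \<Rightarrow> 'a \<Rightarrow> 'a \<Rightarrow> ennreal" where
  "R_reg_min gp gm x y = Inf {r. regularized_rate gp gm x y r}"

definition R_reg_max :: "'a::ordered_comm_monoid_add \<Rightarrow> 'a \<Rightarrow> 'a \<Rightarrow> 'a \<Rightarrow> ennreal" where
  "R_reg_max gp gm x y = Sup {r. regularized_rate gp gm x y r}"

text \<open>
  In the theorem, $x, y \ge 0$ makes every \<open>f x / f y\<close> nonnegative, so the embedding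
  \<^const>\<open>ennreal\<close>, which sends negative reals to 0, does not alter these ratios.
\<close>

end

theory Submission
  imports Defs
begin

text \<open>
  The rate \<open>0\<close> is attained because \<open>x \<ge> 0\<close>. If \<open>m/n\<close> is close to a regularized rate, applying a
  functional \<open>f\<close> to the conversion inequality and dividing by \<open>m\<close> bounds the rate by
  \<open>f x / f y\<close>, since the generators contribute only \<open>k (f gp - f gm)\<close> with \<open>k\<close> of order
  \<open>\<epsilon> max m n\<close>. The infimum over all functionals is at most the infimum over the extremal ones,
  so it remains to show that every fraction \<open>m/n\<close> below the extremal infimum is a rate. For
  such a fraction \<open>f (n x) \<ge> f (m y)\<close> for all extremal \<open>f\<close>, and the claim is the separation
  theorem \<open>extremal_functionals_detect_order\<close>: such inequalities force
  \<open>N a + k gp \<ge> N b + k gm\<close> with \<open>k/N\<close> arbitrarily small.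

  The separation theorem combines Hahn--Banach and Krein--Milman. Both come from one application
  of Zorn's lemma, which involves no topology. Work with pairs \<open>(a, b)\<close> as formal differences
  \<open>a - b\<close>, and let \<open>u = gp - gm\<close>, an order unit. Its gauge
  \<open>p v = inf {s. s u \<ge> v}\<close> is sublinear, and the functionals below \<open>p\<close> are
  the functionals with value \<open>1\<close> on \<open>u\<close>. A sublinear function \<open>q \<le> p\<close> stands for the closed convex
  set of the functionals below it, of which \<open>q\<close> is the support function. The face on which
  \<open>f z\<close> takes its maximal value \<open>q z\<close> has the support function
  \<open>inf n. q (v + n z) - n q z\<close>, because \<open>f v = f (v + n z) - n f z\<close>
  (\<open>facial_exposed\<close>). Faces are closed under infima of chains (\<open>facial_chain_Inf\<close>), so below
  every face there is a minimal one. Minimality means that exposing it further changes nothing,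
  that is, \<open>q v \<le> q (v + z) - q z\<close>, so \<open>q\<close> is additive: the minimal face is a single functional,
  and being a face makes this functional extremal (\<open>minimal_facial_extremal\<close>). Starting from the
  face on which \<open>f b - f a\<close> equals \<open>p (b, a)\<close> gives an extremal \<open>f\<close> with
  \<open>f b - f a = p (b, a)\<close>. Hence the hypothesis of the separation theorem yields
  \<open>p (b, a) \<le> 0\<close>, and by definition of \<open>p\<close> this is the desired inequality up to a catalyst,
  whose cost is bounded in terms of the generators and vanishes under iteration
  (\<open>catalytic_imp_regularized\<close>).
\<close>

section \<open>Multiples\<close>

lemma nfold_0 [simp]: "nfold 0 x = 0"
  by (simp add: nfold_def)

lemma nfold_Suc: "nfold (Suc n) x = x + nfold n x"
  by (simp add: nfold_def add.commute)

lemma nfold_1 [simp]: "nfold (Suc 0) x = x"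
  by (simp add: nfold_Suc)

lemma nfold_plus: "nfold n (x + y) = nfold n x + nfold n y"
  by (simp add: nfold_def sum.distrib)

lemma nfold_add: "nfold (m + n) x = nfold m x + nfold n x"
  by (induction m) (simp_all add: nfold_Suc add.assoc)

lemma nfold_nfold: "nfold m (nfold n x) = nfold (m * n) x"
  by (induction m) (simp_all add: nfold_Suc nfold_add)

lemma nfold_Pair: "nfold n (x, y) = (nfold n x, nfold n y)"
  by (induction n) (simp_all add: nfold_Suc zero_prod_def)

lemma swap_plus: "prod.swap (v + w) = prod.swap v + prod.swap w"
  by (simp add: prod_eq_iff)

lemma swap_nfold: "prod.swap (nfold n v) = nfold n (prod.swap v)"
  by (cases v) (simp add: nfold_Pair)

lemma plus_swap:
  fixes v :: "'a::comm_monoid_add \<times> 'a"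
  shows "v + prod.swap v = (fst v + snd v, fst v + snd v)"
  by (simp add: prod_eq_iff add.commute)

lemma functional_nfold:
  assumes "functional f"
  shows "f (nfold n x) = real n * f x"
proof (induction n)
  case 0
  then show ?case using assms by (simp add: functional_def)
next
  case (Suc n)
  then show ?case using assms by (simp add: functional_def nfold_Suc algebra_simps)
qed

section \<open>Formal differences\<close>

text \<open>
  Nonnegativity of \<open>fst v - snd v\<close> in the Grothendieck group of the monoid. The catalyst \<open>w\<close> makes
  up for the missing cancellation.
\<close>

definition formal_nonneg :: "'a::ordered_comm_monoid_add \<times> 'a \<Rightarrow> bool" where
  "formal_nonneg v \<longleftrightarrow> (\<exists>w. snd v + w \<le> fst v + w)"

lemma formal_nonneg_plus:
  assumes "formal_nonneg v" "formal_nonneg w"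
  shows "formal_nonneg (v + w)"
proof -
  from assms obtain a b where "snd v + a \<le> fst v + a" "snd w + b \<le> fst w + b"
    by (auto simp: formal_nonneg_def)
  from add_mono[OF this] have "snd (v + w) + (a + b) \<le> fst (v + w) + (a + b)"
    by (simp add: ac_simps)
  then show ?thesis unfolding formal_nonneg_def by blast
qed

lemma formal_nonneg_plus_diag [simp]: "formal_nonneg (v + (w, w)) \<longleftrightarrow> formal_nonneg v"
proof
  assume "formal_nonneg (v + (w, w))"
  then obtain a where "snd v + (w + a) \<le> fst v + (w + a)"
    by (auto simp: formal_nonneg_def ac_simps)
  then show "formal_nonneg v" unfolding formal_nonneg_def by blast
next
  assume "formal_nonneg v"
  moreover have "formal_nonneg (w, w)" by (simp add: formal_nonneg_def)
  ultimately show "formal_nonneg (v + (w, w))" by (rule formal_nonneg_plus)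
qed

lemma formal_nonneg_zero [simp]: "formal_nonneg 0"
  by (simp add: formal_nonneg_def)

lemma formal_nonneg_nfold: "formal_nonneg v \<Longrightarrow> formal_nonneg (nfold n v)"
  by (induction n) (simp_all add: nfold_Suc formal_nonneg_plus)

lemma formal_nonnegI: "y \<le> x \<Longrightarrow> formal_nonneg (x, y)"
  by (auto simp: formal_nonneg_def intro: add_right_mono)

definition difference :: "('a::ordered_comm_monoid_add \<Rightarrow> real) \<Rightarrow> 'a \<times> 'a \<Rightarrow> real" where
  "difference f v = f (fst v) - f (snd v)"

lemma difference_plus:
  "functional f \<Longrightarrow> difference f (v + w) = difference f v + difference f w"
  by (simp add: difference_def functional_def)

lemma difference_nfold: "functional f \<Longrightarrow> difference f (nfold n v) = real n * difference f v"
  by (cases v) (simp add: difference_def nfold_Pair functional_nfold algebra_simps)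

lemma difference_swap [simp]: "difference f (prod.swap v) = - difference f v"
  by (simp add: difference_def)

lemma difference_nonneg: "functional f \<Longrightarrow> formal_nonneg v \<Longrightarrow> 0 \<le> difference f v"
  by (fastforce simp: difference_def functional_def formal_nonneg_def)

section \<open>Sublinear functions on formal differences\<close>

text \<open>
  Invariance under adding a diagonal pair says that \<open>q\<close> depends only on the formal difference.
  Only one inequality of \<open>\<nat>\<close>-homogeneity is required; the other one follows from subadditivity.
\<close>

definition sublinear :: "('a::ordered_comm_monoid_add \<times> 'a \<Rightarrow> real) \<Rightarrow> bool" where
  "sublinear q \<longleftrightarrow> q 0 = 0 \<and> (\<forall>v w. q (v + w) \<le> q v + q w) \<and>
     (\<forall>n v. real n * q v \<le> q (nfold n v)) \<and> (\<forall>v w. q (v + (w, w)) = q v)"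

lemma sublinearD:
  assumes "sublinear q"
  shows sublinear_zero: "q 0 = 0" and sublinear_plus: "q (v + w) \<le> q v + q w"
    and sublinear_plus_diag: "q (v + (d, d)) = q v"
  using assms unfolding sublinear_def by blast+

lemma sublinear_nfold:
  assumes "sublinear q"
  shows "q (nfold n v) = real n * q v"
proof (rule antisym)
  show "q (nfold n v) \<le> real n * q v"
  proof (induction n)
    case 0
    then show ?case using sublinear_zero[OF assms] by simp
  next
    case (Suc n)
    have "q (nfold (Suc n) v) \<le> q v + q (nfold n v)"
      unfolding nfold_Suc by (rule sublinear_plus[OF assms])
    with Suc show ?case by (simp add: algebra_simps)
  qed
  show "real n * q v \<le> q (nfold n v)"
    using assms unfolding sublinear_def by blast
qed

lemma sublinear_diag: "sublinear q \<Longrightarrow> q (w, w) = 0"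
  using sublinear_plus_diag[of q 0 w] by (simp add: sublinear_zero)

text \<open>
  This bounds a sublinear function from below by an upper bound for it, which keeps the infima
  below finite.
\<close>

lemma sublinear_swap_ge:
  assumes "sublinear q"
  shows "- q (prod.swap v) \<le> q v"
proof -
  have "0 = q (v + prod.swap v)"
    using assms by (simp add: plus_swap sublinear_diag)
  also have "\<dots> \<le> q v + q (prod.swap v)"
    by (rule sublinear_plus[OF assms])
  finally show ?thesis by simp
qed

text \<open>
  The support function of the face on which the functionals \<open>f\<close> below \<open>q\<close> satisfy \<open>f z = q z\<close>.
\<close>

definition exposed ::
    "('a::ordered_comm_monoid_add \<times> 'a \<Rightarrow> real) \<Rightarrow> 'a \<times> 'a \<Rightarrow> 'a \<times> 'a \<Rightarrow> real" where
  "exposed q z v = (INF n. q (v + nfold n z) - real n * q z)"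

lemma exposed_bdd_below:
  assumes "sublinear q"
  shows "bdd_below (range (\<lambda>n. q (v + nfold n z) - real n * q z))"
proof (rule bdd_belowI2)
  fix n
  have "real n * q z = q (nfold n z + (v + prod.swap v))"
    by (simp add: plus_swap sublinear_plus_diag[OF assms] sublinear_nfold[OF assms])
  also have "\<dots> = q ((v + nfold n z) + prod.swap v)" by (simp add: ac_simps)
  also have "\<dots> \<le> q (v + nfold n z) + q (prod.swap v)"
    by (rule sublinear_plus[OF assms])
  finally show "- q (prod.swap v) \<le> q (v + nfold n z) - real n * q z" by simp
qed

lemma exposed_le:
  "sublinear q \<Longrightarrow> exposed q z v \<le> q (v + nfold n z) - real n * q z"
  unfolding exposed_def by (rule cINF_lower[OF exposed_bdd_below]) simp_all

lemma exposed_le_self: "sublinear q \<Longrightarrow> exposed q z v \<le> q v"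
  using exposed_le[of q z v 0] by simp

text \<open>
  This is what forces \<open>f z \<ge> q z\<close> for the functionals below \<^term>\<open>exposed q z\<close>.
\<close>

lemma exposed_swap_le: "sublinear q \<Longrightarrow> exposed q z (prod.swap z) \<le> - q z"
  using exposed_le[of q z "prod.swap z" 1]
  by (simp add: add.commute[of "prod.swap z"] plus_swap sublinear_diag)

lemma exposed_greatest:
  "(\<And>n. b \<le> q (v + nfold n z) - real n * q z) \<Longrightarrow> b \<le> exposed q z v"
  unfolding exposed_def by (rule cINF_greatest) simp_all

lemma sublinear_exposed:
  assumes q: "sublinear q"
  shows "sublinear (exposed q z)"
  unfolding sublinear_def
proof (intro conjI allI)
  have zero: "exposed q z 0 = 0"
    using sublinear_nfold[OF q] by (simp add: exposed_def)
  then show "exposed q z 0 = 0" .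
  have sub: "q (v + w) \<le> q v + q w" for v w
    by (rule sublinear_plus[OF q])
  show "exposed q z (v + w) \<le> exposed q z v + exposed q z w" for v w
  proof -
    have "exposed q z (v + w) - (q (w + nfold m z) - real m * q z) \<le> exposed q z v" for m
    proof (rule exposed_greatest)
      fix n
      have "exposed q z (v + w) \<le> q ((v + w) + nfold (n + m) z) - real (n + m) * q z"
        by (rule exposed_le[OF q])
      also have "(v + w) + nfold (n + m) z = (v + nfold n z) + (w + nfold m z)"
        by (simp add: nfold_add ac_simps)
      also have "q \<dots> \<le> q (v + nfold n z) + q (w + nfold m z)"
        by (rule sub)
      finally show "exposed q z (v + w) - (q (w + nfold m z) - real m * q z)
          \<le> q (v + nfold n z) - real n * q z"
        by (simp add: algebra_simps)
    qed
    then have "exposed q z (v + w) - exposed q z v \<le> exposed q z w"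
      by (intro exposed_greatest) (simp add: algebra_simps)
    then show ?thesis by simp
  qed
  show "real m * exposed q z v \<le> exposed q z (nfold m v)" for m v
  proof (cases "m = 0")
    case True
    then show ?thesis using zero by simp
  next
    case False
    show ?thesis
    proof (rule exposed_greatest)
      fix n
      \<comment> \<open>Filling up \<open>n\<close> to the multiple \<open>m * n\<close> of \<open>m\<close> costs at most the corresponding
        multiple of \<open>q z\<close>, by subadditivity; then \<open>m\<close> can be factored out.\<close>
      have eq: "(nfold m v + nfold n z) + nfold (m * n - n) z = nfold m (v + nfold n z)"
      proof -
        have "n + (m * n - n) = m * n" using False by (cases m) simp_all
        then show ?thesis
          by (metis add.assoc nfold_add nfold_nfold nfold_plus)
      qed
      have "real m * exposed q z v \<le> real m * (q (v + nfold n z) - real n * q z)"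
        by (intro mult_left_mono exposed_le[OF q]) simp
      also have "\<dots> = q (nfold m (v + nfold n z)) - real (m * n) * q z"
        by (simp add: sublinear_nfold[OF q] algebra_simps)
      also have "\<dots> \<le> q (nfold m v + nfold n z) + q (nfold (m * n - n) z) - real (m * n) * q z"
        using sub[of "nfold m v + nfold n z" "nfold (m * n - n) z"] eq by simp
      also have "\<dots> = q (nfold m v + nfold n z) - real n * q z"
        using False by (cases m) (simp_all add: sublinear_nfold[OF q] algebra_simps)
      finally show "real m * exposed q z v \<le> q (nfold m v + nfold n z) - real n * q z" .
    qed
  qed
  have diag: "q (v + (w, w) + nfold n z) = q (v + nfold n z)" for v w n
  proof -
    have "v + (w, w) + nfold n z = v + nfold n z + (w, w)" by (simp add: ac_simps)
    then show ?thesis using sublinear_plus_diag[OF q] by metis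
  qed
  show "exposed q z (v + (w, w)) = exposed q z v" for v w
    by (simp add: exposed_def diag)
qed

section \<open>The gauge of the order unit\<close>

text \<open>
  With \<open>u = gp - gm\<close>, these are the rational \<open>s\<close> with \<open>s u - v \<ge> 0\<close>, cleared of denominators. The
  two counters \<open>j\<close> and \<open>k\<close> allow negative \<open>s\<close>, so that the gauge is at most \<open>-1\<close> at \<open>- u\<close> and
  the functionals below it are normalised at \<open>u\<close>.
\<close>

definition upper_slopes ::
    "'a::ordered_comm_monoid_add \<Rightarrow> 'a \<Rightarrow> 'a \<times> 'a \<Rightarrow> real set" where
  "upper_slopes gp gm v = {s. \<exists>j k n. s = (real j - real k) / real n \<and> n > 0 \<and>
     formal_nonneg (nfold j (gp, gm) + nfold k (gm, gp) + nfold n (prod.swap v))}"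

definition unit_gauge :: "'a::ordered_comm_monoid_add \<Rightarrow> 'a \<Rightarrow> 'a \<times> 'a \<Rightarrow> real" where
  "unit_gauge gp gm v = Inf (upper_slopes gp gm v)"

text \<open>
  The degenerate case in which a positive multiple of the order unit is nonpositive. Then every
  functional vanishes, and the slopes above are unbounded below.
\<close>

definition collapsed :: "'a::ordered_comm_monoid_add \<Rightarrow> 'a \<Rightarrow> bool" where
  "collapsed gp gm \<longleftrightarrow> (\<exists>d>0. formal_nonneg (nfold d (gm, gp)))"

lemma generating_pair_formal:
  assumes "generating_pair gp gm"
  shows "\<exists>l. formal_nonneg (nfold l (gp, gm) + v)"
proof -
  obtain n1 where n1: "nfold n1 gp \<ge> snd v + nfold n1 gm"
    using assms unfolding generating_pair_def by blast
  obtain n2 where n2: "nfold n2 gp + fst v \<ge> nfold n2 gm"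
    using assms unfolding generating_pair_def by blast
  have "nfold (n1 + n2) gm + snd v \<le> nfold (n1 + n2) gp + fst v"
    using add_mono[OF n1 n2] by (simp add: nfold_add ac_simps)
  then have "formal_nonneg (nfold (n1 + n2) (gp, gm) + v)"
    by (cases v) (simp add: nfold_Pair formal_nonnegI)
  then show ?thesis by blast
qed

lemma formal_unit_cancel:
  assumes "formal_nonneg (nfold j (gp, gm) + nfold k (gm, gp) + v)" and "j \<le> k"
  shows "formal_nonneg (nfold (k - j) (gm, gp) + v)"
proof -
  have "nfold k (gm, gp) = nfold j (gm, gp) + nfold (k - j) (gm, gp)"
    using assms(2) by (simp flip: nfold_add)
  then have "nfold j (gp, gm) + nfold k (gm, gp) + v =
      (nfold (k - j) (gm, gp) + v) + (nfold j gp + nfold j gm, nfold j gp + nfold j gm)"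
    by (simp add: nfold_Pair prod_eq_iff ac_simps)
  with assms(1) show ?thesis by simp
qed

text \<open>
  If \<open>l u + v \<ge> 0\<close> and \<open>s u - v \<ge> 0\<close>, then \<open>(l + s) u \<ge> 0\<close>. A negative \<open>l + s\<close> would make a
  positive multiple of \<open>u\<close> nonpositive.
\<close>

lemma upper_slopes_lower_bound:
  assumes "\<not> collapsed gp gm" and l: "formal_nonneg (nfold l (gp, gm) + v)"
    and "s \<in> upper_slopes gp gm v"
  shows "- real l \<le> s"
proof -
  from assms(3) obtain j k n where s: "s = (real j - real k) / real n" "n > 0"
    and nn: "formal_nonneg (nfold j (gp, gm) + nfold k (gm, gp) + nfold n (prod.swap v))"
    by (auto simp: upper_slopes_def)
  have "formal_nonneg ((nfold j (gp, gm) + nfold k (gm, gp) + nfold n (prod.swap v)) +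
      nfold n (nfold l (gp, gm) + v))"
    by (intro formal_nonneg_plus nn formal_nonneg_nfold l)
  also have "(nfold j (gp, gm) + nfold k (gm, gp) + nfold n (prod.swap v)) +
      nfold n (nfold l (gp, gm) + v) =
      (nfold (j + n * l) (gp, gm) + nfold k (gm, gp) + 0) + nfold n (v + prod.swap v)"
    by (simp add: nfold_plus nfold_nfold nfold_add ac_simps)
  also have "nfold n (v + prod.swap v) =
      (nfold n (fst v + snd v), nfold n (fst v + snd v))"
    by (simp add: plus_swap nfold_Pair)
  finally have unit: "formal_nonneg (nfold (j + n * l) (gp, gm) + nfold k (gm, gp) + 0)"
    by (simp only: formal_nonneg_plus_diag)
  have "\<not> j + n * l < k"
  proof
    assume less: "j + n * l < k"
    have "formal_nonneg (nfold (k - (j + n * l)) (gm, gp))"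
      using formal_unit_cancel[OF unit less_imp_le[OF less]] by (simp only: add_0_right)
    moreover have "0 < k - (j + n * l)" using less by simp
    ultimately show False using assms(1) unfolding collapsed_def by blast
  qed
  then have "real k \<le> real j + real n * real l"
    by (metis not_less of_nat_add of_nat_le_iff of_nat_mult)
  then show ?thesis unfolding s(1) using s(2) by (simp add: field_simps)
qed

lemma upper_slopes_bdd_below:
  "generating_pair gp gm \<Longrightarrow> \<not> collapsed gp gm \<Longrightarrow> bdd_below (upper_slopes gp gm v)"
  by (meson bdd_belowI generating_pair_formal upper_slopes_lower_bound)

lemma upper_slopes_nonempty:
  assumes "generating_pair gp gm"
  shows "upper_slopes gp gm v \<noteq> {}"
proof -
  from generating_pair_formal[OF assms] obtain l
    where "formal_nonneg (nfold l (gp, gm) + prod.swap v)" by blast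
  then have "(real l - real 0) / real 1 \<in> upper_slopes gp gm v"
    unfolding upper_slopes_def mem_Collect_eq
    by (intro exI[of _ l] exI[of _ 0] exI[of _ 1]) simp
  then show ?thesis by blast
qed

lemma upper_slopes_plus:
  assumes "s \<in> upper_slopes gp gm v" and "t \<in> upper_slopes gp gm w"
  shows "s + t \<in> upper_slopes gp gm (v + w)"
proof -
  from assms(1) obtain j k n where s: "s = (real j - real k) / real n" "n > 0"
    and 1: "formal_nonneg (nfold j (gp, gm) + nfold k (gm, gp) + nfold n (prod.swap v))"
    by (auto simp: upper_slopes_def)
  from assms(2) obtain j' k' n' where t: "t = (real j' - real k') / real n'" "n' > 0"
    and 2: "formal_nonneg (nfold j' (gp, gm) + nfold k' (gm, gp) + nfold n' (prod.swap w))"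
    by (auto simp: upper_slopes_def)
  have "formal_nonneg (nfold n' (nfold j (gp, gm) + nfold k (gm, gp) + nfold n (prod.swap v))
      + nfold n (nfold j' (gp, gm) + nfold k' (gm, gp) + nfold n' (prod.swap w)))"
    by (intro formal_nonneg_plus formal_nonneg_nfold 1 2)
  also have "nfold n' (nfold j (gp, gm) + nfold k (gm, gp) + nfold n (prod.swap v))
      + nfold n (nfold j' (gp, gm) + nfold k' (gm, gp) + nfold n' (prod.swap w))
      = nfold (n' * j + n * j') (gp, gm) + nfold (n' * k + n * k') (gm, gp)
        + nfold (n * n') (prod.swap (v + w))"
    by (simp add: nfold_plus nfold_nfold nfold_add swap_plus mult.commute[of n' n] add_ac)
  finally have "formal_nonneg (nfold (n' * j + n * j') (gp, gm)
      + nfold (n' * k + n * k') (gm, gp) + nfold (n * n') (prod.swap (v + w)))" .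
  moreover have "s + t = (real (n' * j + n * j') - real (n' * k + n * k')) / real (n * n')"
    unfolding s(1) t(1) using s(2) t(2) by (simp add: field_simps)
  moreover have "n * n' > 0" using s t by simp
  ultimately show ?thesis unfolding upper_slopes_def by blast
qed

lemma sublinear_unit_gauge:
  assumes gen: "generating_pair gp gm" and nc: "\<not> collapsed gp gm"
  shows "sublinear (unit_gauge gp gm)"
proof -
  note bdd = upper_slopes_bdd_below[OF gen nc]
  note ne = upper_slopes_nonempty[OF gen]
  have zero: "unit_gauge gp gm 0 = 0"
  proof (rule antisym)
    have "(real 0 - real 0) / real 1 \<in> upper_slopes gp gm 0"
      unfolding upper_slopes_def mem_Collect_eq
      by (intro exI[of _ 0] exI[of _ 1])
        (simp add: zero_prod_def formal_nonneg_zero[unfolded zero_prod_def])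
    then show "unit_gauge gp gm 0 \<le> 0"
      unfolding unit_gauge_def using cInf_lower[OF _ bdd, of _ 0] by fastforce
    show "0 \<le> unit_gauge gp gm 0"
      unfolding unit_gauge_def using upper_slopes_lower_bound[OF nc, of 0 0]
      by (intro cInf_greatest ne) simp
  qed
  have sub: "unit_gauge gp gm (v + w) \<le> unit_gauge gp gm v + unit_gauge gp gm w" for v w
  proof -
    have "unit_gauge gp gm (v + w) \<le> s + t"
      if "s \<in> upper_slopes gp gm v" "t \<in> upper_slopes gp gm w" for s t
      unfolding unit_gauge_def by (intro cInf_lower bdd upper_slopes_plus that)
    then have "unit_gauge gp gm (v + w) - t \<le> unit_gauge gp gm v" if "t \<in> upper_slopes gp gm w" for t
      unfolding unit_gauge_def[of _ _ v]
      by (intro cInf_greatest ne) (use that in \<open>force simp: algebra_simps\<close>)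
    then have "unit_gauge gp gm (v + w) - unit_gauge gp gm v \<le> unit_gauge gp gm w"
      unfolding unit_gauge_def[of _ _ w] by (intro cInf_greatest ne) (force simp: algebra_simps)
    then show ?thesis by simp
  qed
  have hom: "real m * unit_gauge gp gm v \<le> unit_gauge gp gm (nfold m v)" for m v
  proof (cases "m = 0")
    case True
    then show ?thesis by (simp add: zero)
  next
    case False
    show ?thesis unfolding unit_gauge_def[of _ _ "nfold m v"]
    proof (intro cInf_greatest ne)
      fix s assume "s \<in> upper_slopes gp gm (nfold m v)"
      then obtain j k n where s: "s = (real j - real k) / real n" "n > 0" and
        "formal_nonneg (nfold j (gp, gm) + nfold k (gm, gp) + nfold n (prod.swap (nfold m v)))"
        by (auto simp: upper_slopes_def)
      then have "(real j - real k) / real (n * m) \<in> upper_slopes gp gm v"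
        unfolding upper_slopes_def mem_Collect_eq using False
        by (intro exI[of _ j] exI[of _ k] exI[of _ "n * m"]) (simp add: swap_nfold nfold_nfold)
      then have "unit_gauge gp gm v \<le> (real j - real k) / real (n * m)"
        unfolding unit_gauge_def by (intro cInf_lower bdd)
      then show "real m * unit_gauge gp gm v \<le> s"
        unfolding s(1) using s(2) False by (simp add: field_simps)
    qed
  qed
  have "formal_nonneg (c + nfold n (prod.swap (v + (w, w)))) \<longleftrightarrow>
      formal_nonneg (c + nfold n (prod.swap v))" for c v n and w :: 'a
  proof -
    have "c + nfold n (prod.swap (v + (w, w))) =
        (c + nfold n (prod.swap v)) + (nfold n w, nfold n w)"
      by (simp add: swap_plus nfold_plus nfold_Pair add.assoc)
    then show ?thesis by simp
  qed
  then have "unit_gauge gp gm (v + (w, w)) = unit_gauge gp gm v" for v w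
    by (simp add: unit_gauge_def upper_slopes_def)
  with zero sub hom show ?thesis unfolding sublinear_def by blast
qed

lemma unit_gauge_le:
  assumes "generating_pair gp gm" "\<not> collapsed gp gm" "n > 0"
    and "formal_nonneg (nfold j (gp, gm) + nfold k (gm, gp) + nfold n (prod.swap v))"
  shows "unit_gauge gp gm v \<le> (real j - real k) / real n"
  unfolding unit_gauge_def using assms
  by (intro cInf_lower upper_slopes_bdd_below) (auto simp: upper_slopes_def)

lemma unit_gauge_bounds:
  assumes "generating_pair gp gm" "\<not> collapsed gp gm"
  shows "unit_gauge gp gm (gp, gm) \<le> 1" and "unit_gauge gp gm (gm, gp) \<le> - 1"
    and "formal_nonneg v \<Longrightarrow> unit_gauge gp gm (prod.swap v) \<le> 0"
proof -
  have "formal_nonneg (nfold 1 (gp, gm) + nfold 0 (gm, gp) + nfold 1 (prod.swap (gp, gm)))"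
    by (simp add: formal_nonneg_def add.commute)
  from unit_gauge_le[OF assms _ this] show "unit_gauge gp gm (gp, gm) \<le> 1" by simp
  have "formal_nonneg (nfold 0 (gp, gm) + nfold 1 (gm, gp) + nfold 1 (prod.swap (gm, gp)))"
    by (simp add: formal_nonneg_def add.commute)
  from unit_gauge_le[OF assms _ this] show "unit_gauge gp gm (gm, gp) \<le> - 1" by simp
  assume "formal_nonneg v"
  then have "formal_nonneg
      (nfold 0 (gp, gm) + nfold 0 (gm, gp) + nfold 1 (prod.swap (prod.swap v)))" by simp
  from unit_gauge_le[OF assms _ this] show "unit_gauge gp gm (prod.swap v) \<le> 0" by simp
qed

section \<open>Faces of the set of normalised functionals\<close>

text \<open>
  The last clause says that the functionals below \<open>q\<close> form a face: if a sum \<open>f + h\<close> of two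
  functionals lies below \<open>q\<close>, so does \<open>f\<close> rescaled to have value \<open>1\<close> at the order unit. Written
  without division, it also covers functionals that vanish at the order unit.
\<close>

definition facial ::
    "'a::ordered_comm_monoid_add \<Rightarrow> 'a \<Rightarrow> ('a \<times> 'a \<Rightarrow> real) \<Rightarrow> bool" where
  "facial gp gm q \<longleftrightarrow> sublinear q \<and> q \<le> unit_gauge gp gm \<and>
     (\<forall>f h. functional f \<longrightarrow> functional h \<longrightarrow> (\<forall>v. difference f v + difference h v \<le> q v) \<longrightarrow>
        (\<forall>v. difference f v \<le> difference f (gp, gm) * q v))"

lemma difference_unit_nonneg:
  "generating_pair gp gm \<Longrightarrow> functional f \<Longrightarrow> 0 \<le> difference f (gp, gm)"
  by (simp add: generating_pair_def functional_def difference_def)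

text \<open>
  Monotonicity alone puts every functional \<open>f\<close>, rescaled, below the gauge: \<open>s u \<ge> v\<close>
  implies \<open>f v \<le> s f u\<close>.
\<close>

lemma facial_unit_gauge:
  assumes gen: "generating_pair gp gm" and nc: "\<not> collapsed gp gm"
  shows "facial gp gm (unit_gauge gp gm)"
proof -
  have "difference f v \<le> difference f (gp, gm) * unit_gauge gp gm v" if f: "functional f" for f v
  proof (cases "difference f (gp, gm) = 0")
    case True
    obtain l where "formal_nonneg (nfold l (gp, gm) + prod.swap v)"
      using generating_pair_formal[OF gen] by blast
    from difference_nonneg[OF f this] True show ?thesis
      by (simp add: difference_plus[OF f] difference_nfold[OF f])
  next
    case False
    with difference_unit_nonneg[OF gen f] have pos: "0 < difference f (gp, gm)" by simp
    have "difference f v / difference f (gp, gm) \<le> unit_gauge gp gm v"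
      unfolding unit_gauge_def
    proof (intro cInf_greatest upper_slopes_nonempty[OF gen])
      fix s assume "s \<in> upper_slopes gp gm v"
      then obtain j k n where s: "s = (real j - real k) / real n" "n > 0"
        and nn: "formal_nonneg (nfold j (gp, gm) + nfold k (gm, gp) + nfold n (prod.swap v))"
        by (auto simp: upper_slopes_def)
      have "difference f (gm, gp) = - difference f (gp, gm)" by (simp add: difference_def)
      with difference_nonneg[OF f nn]
      have "real n * difference f v \<le> (real j - real k) * difference f (gp, gm)"
        by (simp add: difference_plus[OF f] difference_nfold[OF f] algebra_simps)
      then show "difference f v / difference f (gp, gm) \<le> s"
        unfolding s(1) using s(2) pos by (simp add: field_simps)
    qed
    with pos show ?thesis by (simp add: field_simps)
  qed
  then show ?thesis using sublinear_unit_gauge[OF assms] by (simp add: facial_def)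
qed

text \<open>
  A face of a face is a face. If \<open>f + h\<close> attains the maximum \<open>q z\<close> at \<open>z\<close>, then, since the values of
  \<open>f\<close> and \<open>h\<close> at the order unit add up to \<open>1\<close>, each of them must attain its own share of \<open>q z\<close>.
\<close>

lemma facial_exposed:
  assumes gen: "generating_pair gp gm" and nc: "\<not> collapsed gp gm" and q: "facial gp gm q"
  shows "facial gp gm (exposed q z)"
  unfolding facial_def
proof (intro conjI allI impI)
  have sq: "sublinear q" and le: "q \<le> unit_gauge gp gm" using q by (simp_all add: facial_def)
  have face: "difference f v \<le> difference f (gp, gm) * q v"
    if "functional f" "functional h" "\<And>v. difference f v + difference h v \<le> q v" for f h v
    using q that unfolding facial_def by blast
  show "sublinear (exposed q z)" by (rule sublinear_exposed[OF sq])
  show "exposed q z \<le> unit_gauge gp gm"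
    by (intro le_funI order_trans[OF exposed_le_self[OF sq] le_funD[OF le]])
  fix f h v
  assume f: "functional f" and h: "functional h"
    and sum: "\<forall>v. difference f v + difference h v \<le> exposed q z v"
  have sum_q: "difference f v + difference h v \<le> q v" for v
    by (rule order_trans[OF sum[rule_format] exposed_le_self[OF sq]])
  have fq: "difference f v \<le> difference f (gp, gm) * q v" for v
    using face[OF f h sum_q] .
  have hq: "difference h v \<le> difference h (gp, gm) * q v" for v
    using face[OF h f] sum_q by (simp add: add.commute)
  have one: "difference f (gp, gm) + difference h (gp, gm) = 1"
  proof (rule antisym)
    show "difference f (gp, gm) + difference h (gp, gm) \<le> 1"
      using sum_q[of "(gp, gm)"] le_funD[OF le, of "(gp, gm)"] unit_gauge_bounds(1)[OF gen nc]
      by linarith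
    show "1 \<le> difference f (gp, gm) + difference h (gp, gm)"
      using sum_q[of "(gm, gp)"] le_funD[OF le, of "(gm, gp)"] unit_gauge_bounds(2)[OF gen nc]
      by (simp add: difference_def)
  qed
  have "q z \<le> difference f z + difference h z"
    using sum[rule_format, of "prod.swap z"] exposed_swap_le[OF sq, of z] by simp
  moreover have "q z = difference f (gp, gm) * q z + difference h (gp, gm) * q z"
    using one by (simp flip: distrib_right)
  \<comment> \<open>The two upper bounds \<open>fq\<close> and \<open>hq\<close> at \<open>z\<close> add up to a lower bound for the sum, so both are
    equalities.\<close>
  ultimately have fz: "difference f z = difference f (gp, gm) * q z"
    using fq[of z] hq[of z] by linarith
  show "difference f v \<le> difference f (gp, gm) * exposed q z v"
  proof (cases "difference f (gp, gm) = 0")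
    case True
    then show ?thesis using fq[of v] by simp
  next
    case False
    with difference_unit_nonneg[OF gen f] have pos: "0 < difference f (gp, gm)" by simp
    have "difference f v / difference f (gp, gm) \<le> exposed q z v"
    proof (rule exposed_greatest)
      fix n
      have "difference f v = difference f (v + nfold n z) - real n * difference f z"
        by (simp add: difference_plus[OF f] difference_nfold[OF f])
      also have "\<dots> \<le> difference f (gp, gm) * (q (v + nfold n z) - real n * q z)"
        using fq[of "v + nfold n z"] fz by (simp add: algebra_simps)
      finally show "difference f v / difference f (gp, gm) \<le> q (v + nfold n z) - real n * q z"
        using pos by (simp add: field_simps)
    qed
    with pos show ?thesis by (simp add: field_simps)
  qed
qed

text \<open>
  The infimum over a chain is again subadditive because any two members have a common lower bound
  in the chain. The face property passes to the infimum because a sum below the infimum is below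
  every member.
\<close>

lemma facial_chain_Inf:
  assumes gen: "generating_pair gp gm"
    and C: "\<And>q. q \<in> C \<Longrightarrow> facial gp gm q" "C \<noteq> {}"
    and chain: "\<And>q r. q \<in> C \<Longrightarrow> r \<in> C \<Longrightarrow> q \<le> r \<or> r \<le> q"
  shows "facial gp gm (\<lambda>v. INF q\<in>C. q v)" and "q \<in> C \<Longrightarrow> (\<lambda>v. INF q\<in>C. q v) \<le> q"
proof -
  have sq: "sublinear q" and le: "q v \<le> unit_gauge gp gm v" if "q \<in> C" for q v
    using C(1)[OF that] unfolding facial_def le_fun_def by blast+
  have bdd: "bdd_below ((\<lambda>q. q v) ` C)" for v
  proof (rule bdd_belowI2)
    fix q assume "q \<in> C"
    then show "- unit_gauge gp gm (prod.swap v) \<le> q v"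
      using sublinear_swap_ge[OF sq, of q v] le[of q "prod.swap v"] by linarith
  qed
  have lower: "(INF q\<in>C. q v) \<le> q v" if "q \<in> C" for q v
    by (rule cINF_lower[OF bdd that])
  then show "q \<in> C \<Longrightarrow> (\<lambda>v. INF q\<in>C. q v) \<le> q" by (simp add: le_fun_def)
  have greatest: "b \<le> (INF q\<in>C. q v)" if "\<And>q. q \<in> C \<Longrightarrow> b \<le> q v" for b v
    by (rule cINF_greatest[OF C(2) that])
  show "facial gp gm (\<lambda>v. INF q\<in>C. q v)"
    unfolding facial_def sublinear_def
  proof (intro conjI allI impI)
    have "(\<lambda>q. q 0) ` C = {0}" using sublinear_zero[OF sq] C(2) by (auto simp: image_iff)
    then show "(INF q\<in>C. q 0) = 0" by simp
    show "(INF q\<in>C. q (v + w)) \<le> (INF q\<in>C. q v) + (INF q\<in>C. q w)" for v w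
    proof -
      have two: "(INF q\<in>C. q (v + w)) \<le> q v + r w" if qr: "q \<in> C" "r \<in> C" for q r
      proof -
        from chain[OF qr] obtain p where p: "p \<in> C" "p \<le> q" "p \<le> r"
          using qr by blast
        have "(INF q\<in>C. q (v + w)) \<le> p (v + w)" by (rule lower[OF p(1)])
        also have "\<dots> \<le> p v + p w" by (rule sublinear_plus[OF sq[OF p(1)]])
        also have "\<dots> \<le> q v + r w" by (intro add_mono le_funD[OF p(2)] le_funD[OF p(3)])
        finally show ?thesis .
      qed
      then have "(INF q\<in>C. q (v + w)) - r w \<le> (INF q\<in>C. q v)" if "r \<in> C" for r
        by (intro greatest) (use that in \<open>force simp: algebra_simps\<close>)
      then have "(INF q\<in>C. q (v + w)) - (INF q\<in>C. q v) \<le> (INF q\<in>C. q w)"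
        by (intro greatest) (force simp: algebra_simps)
      then show ?thesis by simp
    qed
    show "real n * (INF q\<in>C. q v) \<le> (INF q\<in>C. q (nfold n v))" for n v
    proof (rule greatest)
      fix q assume "q \<in> C"
      then show "real n * (INF q\<in>C. q v) \<le> q (nfold n v)"
        by (simp add: sublinear_nfold[OF sq] lower mult_left_mono)
    qed
    show "(INF q\<in>C. q (v + (w, w))) = (INF q\<in>C. q v)" for v w
      by (intro arg_cong[where f = Inf] image_cong refl sublinear_plus_diag[OF sq])
    show "(\<lambda>v. INF q\<in>C. q v) \<le> unit_gauge gp gm"
    proof (rule le_funI)
      fix v
      obtain c where "c \<in> C" using C(2) by blast
      then show "(INF q\<in>C. q v) \<le> unit_gauge gp gm v"
        by (intro order_trans[OF lower le])
    qed
    fix f h v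
    assume f: "functional f" and h: "functional h"
      and sum: "\<forall>v. difference f v + difference h v \<le> (INF q\<in>C. q v)"
    have fq: "difference f v \<le> difference f (gp, gm) * q v" if "q \<in> C" for q
    proof -
      have "difference f w + difference h w \<le> q w" for w
        by (rule order_trans[OF sum[rule_format] lower[OF that]])
      then show ?thesis using C(1)[OF that] f h unfolding facial_def by blast
    qed
    show "difference f v \<le> difference f (gp, gm) * (INF q\<in>C. q v)"
    proof (cases "difference f (gp, gm) = 0")
      case True
      then show ?thesis using fq C(2) by fastforce
    next
      case False
      with difference_unit_nonneg[OF gen f] have pos: "0 < difference f (gp, gm)" by simp
      have "difference f v / difference f (gp, gm) \<le> (INF q\<in>C. q v)"
        using fq pos by (intro greatest) (simp add: field_simps)
      with pos show ?thesis by (simp add: field_simps)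
    qed
  qed
qed

lemma minimal_facial:
  assumes gen: "generating_pair gp gm" and q0: "facial gp gm q0"
  obtains q where "facial gp gm q" "q \<le> q0" "\<And>r. facial gp gm r \<Longrightarrow> r \<le> q \<Longrightarrow> r = q"
proof -
  define F where "F = {q. facial gp gm q \<and> q \<le> q0}"
  have "\<exists>m\<in>F. \<forall>a\<in>F. a \<le> m \<longrightarrow> a = m"
  proof (rule predicate_Zorn)
    show "partial_order_on F (relation_of (\<lambda>q r. r \<le> q) F)"
      by (rule partial_order_on_relation_ofI) auto
    fix C assume "C \<in> Chains (relation_of (\<lambda>q r. r \<le> q) F)"
    then have CF: "C \<subseteq> F" and chain: "\<And>q r. q \<in> C \<Longrightarrow> r \<in> C \<Longrightarrow> q \<le> r \<or> r \<le> q"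
      by (auto simp: Chains_def relation_of_def)
    show "\<exists>u\<in>F. \<forall>a\<in>C. u \<le> a"
    proof (cases "C = {}")
      case True
      then show ?thesis using q0 by (auto simp: F_def)
    next
      case False
      have fac: "\<And>q. q \<in> C \<Longrightarrow> facial gp gm q" using CF by (auto simp: F_def)
      have facial_inf: "facial gp gm (\<lambda>v. INF q\<in>C. q v)"
        by (rule facial_chain_Inf(1)[OF gen fac False chain])
      have inf_le: "(\<lambda>v. INF q\<in>C. q v) \<le> q" if "q \<in> C" for q
        by (rule facial_chain_Inf(2)[OF gen fac False chain that])
      from False obtain c where c: "c \<in> C" by blast
      have "(\<lambda>v. INF q\<in>C. q v) \<le> q0" using inf_le[OF c] c CF by (force simp: F_def)
      then have "(\<lambda>v. INF q\<in>C. q v) \<in> F" using facial_inf by (simp add: F_def)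
      then show ?thesis using inf_le by blast
    qed
  qed
  then obtain q where q: "q \<in> F" and min: "\<And>r. r \<in> F \<Longrightarrow> r \<le> q \<Longrightarrow> r = q" by blast
  show thesis
  proof (rule that)
    show "facial gp gm q" "q \<le> q0" using q by (auto simp: F_def)
    show "r = q" if "facial gp gm r" "r \<le> q" for r
      using min that q by (auto simp: F_def)
  qed
qed

text \<open>
  By minimality, exposing \<open>q\<close> at any \<open>z\<close> leaves it unchanged, which gives superadditivity. An
  additive \<open>q\<close> is the difference of a functional \<open>f\<close>. A functional \<open>f'\<close> dominated by \<open>f\<close> is a
  summand of \<open>f\<close>, so the face property gives \<open>f' \<le> f' u \<cdot> f\<close> on formal differences; since both
  sides are odd, equality holds.
\<close>

lemma minimal_facial_extremal:
  assumes gen: "generating_pair gp gm" and nc: "\<not> collapsed gp gm"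
    and q: "facial gp gm q" and min: "\<And>r. facial gp gm r \<Longrightarrow> r \<le> q \<Longrightarrow> r = q"
  obtains f where "extremal_functional f" "difference f = q"
proof -
  have sq: "sublinear q" and le: "q \<le> unit_gauge gp gm" using q by (simp_all add: facial_def)
  have add: "q (v + z) = q v + q z" for v z
  proof (rule antisym)
    show "q (v + z) \<le> q v + q z" by (rule sublinear_plus[OF sq])
    have "exposed q z = q"
      by (intro min facial_exposed[OF gen nc q]) (simp add: le_fun_def exposed_le_self[OF sq])
    with exposed_le[OF sq, of z v 1] show "q v + q z \<le> q (v + z)" by simp
  qed
  have swap: "q (prod.swap v) = - q v" for v
    using add[of v "prod.swap v"] sublinear_diag[OF sq] by (simp add: plus_swap)
  define f where "f x = q (x, 0)" for x
  have diff: "difference f v = q v" for v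
    using add[of "(fst v, 0)" "(0, snd v)"] swap[of "(snd v, 0)"]
    by (simp add: difference_def f_def)
  have fun_f: "functional f"
    unfolding functional_def
  proof (intro conjI allI impI)
    show "f (x + y) = f x + f y" for x y using add[of "(x, 0)" "(y, 0)"] by (simp add: f_def)
    show "f 0 = 0" using sublinear_diag[OF sq] by (simp add: f_def)
    fix x y :: 'a assume "y \<le> x"
    have "q (y, x) \<le> 0"
      using unit_gauge_bounds(3)[OF gen nc formal_nonnegI[OF \<open>y \<le> x\<close>]] le_funD[OF le, of "(y, x)"]
      by simp
    then show "f y \<le> f x" using diff[of "(y, x)"] by (simp add: difference_def)
  qed
  have "extremal_functional f"
    unfolding extremal_functional_def
  proof (intro conjI allI impI fun_f)
    fix f' assume "functional f' \<and> functional_ge f f'"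
    then have f': "functional f'" and h: "functional (\<lambda>x. f x - f' x)"
      by (simp_all add: functional_ge_def)
    have "difference f' v + difference (\<lambda>x. f x - f' x) v \<le> q v" for v
      using diff[of v] by (simp add: difference_def)
    with f' h q have le': "difference f' v \<le> difference f' (gp, gm) * q v" for v
      unfolding facial_def by blast
    have eq: "difference f' v = difference f' (gp, gm) * q v" for v
      using le'[of v] le'[of "prod.swap v"] by (simp add: swap)
    have "f' x = difference f' (gp, gm) * f x" for x
      using eq[of "(x, 0)"] f' by (simp add: difference_def functional_def f_def)
    then show "\<exists>l\<ge>0. f' = (\<lambda>x. l * f x)"
      using difference_unit_nonneg[OF gen f'] by blast
  qed
  then show thesis using that diff by blast
qed

section \<open>Separation by extremal functionals\<close>

text \<open>
  One catalyst suffices for any number of copies, because it is returned after each use.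
\<close>

lemma catalytic_nfold:
  fixes a b w :: "'a::ordered_comm_monoid_add"
  assumes "b + w \<le> a + w"
  shows "nfold n b + w \<le> nfold n a + w"
proof (induction n)
  case (Suc n)
  have "nfold (Suc n) b + w = b + (nfold n b + w)" by (simp add: nfold_Suc add.assoc)
  also have "\<dots> \<le> b + (nfold n a + w)" by (intro add_left_mono Suc)
  also have "\<dots> = nfold n a + (b + w)" by (simp add: ac_simps)
  also have "\<dots> \<le> nfold n a + (a + w)" by (intro add_left_mono assms)
  also have "\<dots> = nfold (Suc n) a + w" by (simp add: nfold_Suc ac_simps)
  finally show ?case .
qed simp

text \<open>
  The catalyst \<open>w\<close> can be bought and sold for boundedly many generators: \<open>m gp + w \<ge> m gm\<close> and
  \<open>l gp \<ge> w + l gm\<close>. Iterating the catalytic inequality \<open>M'\<close> times spreads this fixed cost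
  \<open>l + m\<close> over \<open>M'\<close> copies.
\<close>

lemma catalytic_imp_regularized:
  assumes gen: "generating_pair gp gm" and "n > 0" and "\<epsilon> > 0"
    and nn: "formal_nonneg (nfold d (gp, gm) + nfold n (a, b))"
  shows "\<exists>N k. N > 0 \<and> real k \<le> (real d / real n + \<epsilon>) * real N \<and>
    nfold N b + nfold k gm \<le> nfold N a + nfold k gp"
proof -
  from nn obtain w where w: "(nfold d gm + nfold n b) + w \<le> (nfold d gp + nfold n a) + w"
    by (auto simp: formal_nonneg_def nfold_Pair)
  obtain l where l1: "w + nfold l gm \<le> nfold l gp"
    using gen unfolding generating_pair_def by blast
  obtain m where m1: "nfold m gm \<le> nfold m gp + w"
    using gen unfolding generating_pair_def by blast
  obtain M :: nat where M: "real (l + m) / \<epsilon> < real M" using reals_Archimedean2 by blast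
  define M' where "M' = Suc M"
  define N where "N = M' * n"
  define k where "k = M' * d + (l + m)"
  have "N > 0" using \<open>n > 0\<close> by (simp add: N_def M'_def)
  moreover have "real k \<le> (real d / real n + \<epsilon>) * real N"
  proof -
    have "real (l + m) \<le> \<epsilon> * real M'"
      using M \<open>\<epsilon> > 0\<close> by (simp add: M'_def field_simps)
    also have "\<dots> \<le> \<epsilon> * real N"
      using \<open>\<epsilon> > 0\<close> \<open>n > 0\<close> by (intro mult_left_mono) (simp_all add: N_def flip: of_nat_mult)
    finally have "real (l + m) \<le> \<epsilon> * real N" .
    moreover have "real (M' * d) = real d / real n * real N"
      using \<open>n > 0\<close> by (simp add: N_def)
    ultimately show ?thesis unfolding k_def of_nat_add[of "M' * d"] distrib_right by linarith
  qed
  moreover have "nfold N b + nfold k gm \<le> nfold N a + nfold k gp"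
  proof -
    have "nfold N b + nfold k gm
        = (nfold M' (nfold d gm + nfold n b) + nfold l gm) + nfold m gm"
      by (simp add: N_def k_def nfold_add nfold_plus nfold_nfold ac_simps)
    also have "\<dots> \<le> (nfold M' (nfold d gm + nfold n b) + nfold l gm) + (nfold m gp + w)"
      by (intro add_left_mono m1)
    also have "\<dots> = (nfold M' (nfold d gm + nfold n b) + w) + (nfold l gm + nfold m gp)"
      by (simp add: ac_simps)
    also have "\<dots> \<le> (nfold M' (nfold d gp + nfold n a) + w) + (nfold l gm + nfold m gp)"
      by (intro add_right_mono catalytic_nfold w)
    also have "\<dots> = (nfold M' (nfold d gp + nfold n a) + nfold m gp) + (w + nfold l gm)"
      by (simp add: ac_simps)
    also have "\<dots> \<le> (nfold M' (nfold d gp + nfold n a) + nfold m gp) + nfold l gp"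
      by (intro add_left_mono l1)
    also have "\<dots> = nfold N a + nfold k gp"
      by (simp add: N_def k_def nfold_add nfold_plus nfold_nfold ac_simps)
    finally show ?thesis .
  qed
  ultimately show ?thesis by blast
qed

text \<open>
  If the order unit is not collapsed, a minimal face inside the one exposed by \<open>(b, a)\<close> is an extremal functional
  with \<open>f b - f a\<close> equal to the gauge of \<open>(b, a)\<close>, which is therefore nonpositive. In the collapsed
  case the order unit is equivalent to \<open>0\<close> up to catalysts, so the inequality holds between any two
  elements up to catalysts.
\<close>

lemma extremal_functionals_detect_order:
  assumes gen: "generating_pair gp gm"
    and ext: "\<And>f. extremal_functional f \<Longrightarrow> f b \<le> f a" and "\<epsilon> > 0"
  shows "\<exists>N k. N > 0 \<and> real k \<le> \<epsilon> * real N \<and> nfold N b + nfold k gm \<le> nfold N a + nfold k gp"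
proof (cases "collapsed gp gm")
  case True
  then obtain d where d: "d > 0" "formal_nonneg (nfold d (gm, gp))" by (auto simp: collapsed_def)
  obtain l where l: "formal_nonneg (nfold l (gp, gm) + (a, b))"
    using generating_pair_formal[OF gen] by blast
  have unit: "formal_nonneg (gp, gm)" using gen by (simp add: generating_pair_def formal_nonnegI)
  \<comment> \<open>\<open>e\<close> copies of the nonnegative unit top up the \<open>l\<close> already used, so that \<open>l * d\<close> negative
    units cancel all of them.\<close>
  define e where "e = l * d - l"
  have e: "l * d = l + e" using d(1) by (cases d) (simp_all add: e_def)
  have "formal_nonneg ((nfold l (gp, gm) + (a, b)) + nfold l (nfold d (gm, gp)) + nfold e (gp, gm))"
    by (intro formal_nonneg_plus l formal_nonneg_nfold d unit)
  also have "(nfold l (gp, gm) + (a, b)) + nfold l (nfold d (gm, gp)) + nfold e (gp, gm)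
      = (nfold 0 (gp, gm) + nfold 1 (a, b)) + nfold (l + e) (gp + gm, gp + gm)"
    unfolding nfold_nfold e by (simp add: nfold_add nfold_plus nfold_Pair ac_simps)
  finally have "formal_nonneg (nfold 0 (gp, gm) + nfold 1 (a, b))"
    by (simp only: nfold_Pair[of "l + e" "gp + gm"] formal_nonneg_plus_diag)
  from catalytic_imp_regularized[OF gen _ \<open>\<epsilon> > 0\<close> this] show ?thesis by simp
next
  case nc: False
  note sg = sublinear_unit_gauge[OF gen nc]
  have "facial gp gm (exposed (unit_gauge gp gm) (b, a))"
    by (rule facial_exposed[OF gen nc facial_unit_gauge[OF gen nc]])
  from minimal_facial[OF gen this] obtain q where q: "facial gp gm q"
    and q_le: "q \<le> exposed (unit_gauge gp gm) (b, a)"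
    and min: "\<And>r. facial gp gm r \<Longrightarrow> r \<le> q \<Longrightarrow> r = q" by blast
  from minimal_facial_extremal[OF gen nc q min] obtain f
    where f: "extremal_functional f" "difference f = q" by blast
  have "f a - f b = q (a, b)" using f(2) by (auto simp: difference_def)
  also have "\<dots> \<le> - unit_gauge gp gm (b, a)"
    using le_funD[OF q_le, of "(a, b)"] exposed_swap_le[OF sg, of "(b, a)"] by simp
  finally have "unit_gauge gp gm (b, a) \<le> 0" using ext[OF f(1)] by simp
  then have "Inf (upper_slopes gp gm (b, a)) < \<epsilon> / 2" using \<open>\<epsilon> > 0\<close> by (simp add: unit_gauge_def[symmetric])
  then obtain s where "s \<in> upper_slopes gp gm (b, a)" and s_less: "s < \<epsilon> / 2"
    using cInf_less_iff[OF upper_slopes_nonempty[OF gen] upper_slopes_bdd_below[OF gen nc]] by blast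
  then obtain j k n where s: "s = (real j - real k) / real n" "n > 0"
    and nn: "formal_nonneg (nfold j (gp, gm) + nfold k (gm, gp) + nfold n (a, b))"
    by (auto simp: upper_slopes_def)
  \<comment> \<open>A negative slope is weakened to \<open>0\<close>, so that only a natural number \<open>i - k\<close> of units is left.\<close>
  define i where "i = max j k"
  have "formal_nonneg ((nfold j (gp, gm) + nfold k (gm, gp) + nfold n (a, b)) + nfold (i - j) (gp, gm))"
    using gen by (intro formal_nonneg_plus nn formal_nonneg_nfold)
      (simp add: generating_pair_def formal_nonnegI)
  also have "(nfold j (gp, gm) + nfold k (gm, gp) + nfold n (a, b)) + nfold (i - j) (gp, gm)
      = (nfold (i - k) (gp, gm) + nfold n (a, b)) + nfold k (gp + gm, gp + gm)"
  proof -
    have "nfold j (gp, gm) + nfold (i - j) (gp, gm) = nfold k (gp, gm) + nfold (i - k) (gp, gm)"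
      by (simp add: i_def flip: nfold_add)
    moreover have "(nfold j (gp, gm) + nfold k (gm, gp) + nfold n (a, b)) + nfold (i - j) (gp, gm)
        = (nfold j (gp, gm) + nfold (i - j) (gp, gm)) + (nfold k (gm, gp) + nfold n (a, b))"
      by (simp only: add_ac)
    moreover have "nfold k (gp + gm, gp + gm) = nfold k (gp, gm) + nfold k (gm, gp)"
      by (simp add: add.commute[of gm gp] flip: nfold_plus)
    ultimately show ?thesis by (simp only: add_ac)
  qed
  finally have "formal_nonneg (nfold (i - k) (gp, gm) + nfold n (a, b))"
    by (simp only: nfold_Pair[of k "gp + gm"] formal_nonneg_plus_diag)
  from catalytic_imp_regularized[OF gen s(2) _ this, of "\<epsilon> / 2"] \<open>\<epsilon> > 0\<close>
  obtain N k' where N: "N > 0" "real k' \<le> (real (i - k) / real n + \<epsilon> / 2) * real N"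
    and ineq: "nfold N b + nfold k' gm \<le> nfold N a + nfold k' gp" by auto
  have "real (i - k) / real n \<le> \<epsilon> / 2"
  proof (cases "j \<le> k")
    case True
    then show ?thesis using \<open>\<epsilon> > 0\<close> by (simp add: i_def)
  next
    case False
    then show ?thesis using s s_less by (simp add: i_def of_nat_diff)
  qed
  then have "(real (i - k) / real n + \<epsilon> / 2) * real N \<le> \<epsilon> * real N"
    by (intro mult_right_mono) linarith+
  with N ineq show ?thesis by (meson order_trans)
qed

section \<open>Rates\<close>

lemma functional_nonneg:
  assumes "functional f" "0 \<le> x"
  shows "0 \<le> f x"
proof -
  have "f 0 \<le> f x" and "f 0 = 0" using assms unfolding functional_def by blast+
  then show ?thesis by simp
qed

lemma regularized_rate_zero:
  assumes "0 \<le> x"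
  shows "regularized_rate gp gm x y 0"
  unfolding regularized_rate_def
proof (intro allI impI)
  fix \<epsilon> :: real and U :: "ennreal set"
  assume "\<epsilon> > 0" and "open U \<and> 0 \<in> U"
  then show "\<exists>m n k. \<not> (m = 0 \<and> n = 0) \<and> of_nat m / of_nat n \<in> U \<and>
      real k \<le> \<epsilon> * real (max m n) \<and> nfold m y + nfold k gm \<le> nfold n x + nfold k gp"
    using assms by (intro exI[of _ 0] exI[of _ 1]) simp
qed

lemma of_nat_divide_ennreal:
  "n > 0 \<Longrightarrow> (of_nat m / of_nat n :: ennreal) = ennreal (real m / real n)"
  by (simp add: ennreal_of_nat_eq_real_of_nat divide_ennreal)

text \<open>
  Suppose that \<open>c\<close> lies strictly between \<open>f x / f y\<close> and the rate. Fractions \<open>m/n > c\<close> have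
  \<open>n < m/c\<close>, so all error terms in the image of the conversion inequality under \<open>f\<close> are
  proportional to \<open>m\<close>. Dividing by \<open>m\<close> shows that the gap \<open>f y - f x / c > 0\<close> is at most a
  constant times \<open>\<epsilon>\<close>.
\<close>

lemma regularized_rate_le_ratio:
  assumes gen: "generating_pair gp gm" and x: "0 \<le> x" and y: "0 \<le> y"
    and r: "regularized_rate gp gm x y r" and f: "functional f" and fy: "f y \<noteq> 0"
  shows "r \<le> ennreal (f x / f y)"
proof (rule ccontr)
  assume "\<not> ?thesis"
  then have "ennreal (f x / f y) < r" by simp
  from dense[OF this] obtain c' where c': "ennreal (f x / f y) < c'" "c' < r" by blast
  then obtain c where c: "c' = ennreal c" "0 \<le> c" by (cases c') auto
  have fx: "0 \<le> f x" and fy: "0 < f y"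
    using functional_nonneg[OF f x] functional_nonneg[OF f y] fy by auto
  have c_gr: "f x / f y < c" using c' c fx fy by (simp add: ennreal_less_iff)
  moreover have "0 \<le> f x / f y" using fx fy by simp
  ultimately have "0 < c" by linarith
  define T where "T = f gp - f gm"
  have T: "0 \<le> T" using difference_unit_nonneg[OF gen f] by (simp add: T_def difference_def)
  \<comment> \<open>The factor by which \<open>max m n\<close> can exceed \<open>m\<close> when \<open>n < m/c\<close>.\<close>
  define D where "D = max 1 (1 / c)"
  have D: "1 \<le> D" by (simp add: D_def)
  define gap where "gap = f y - f x / c"
  have gap: "0 < gap" using c_gr \<open>0 < c\<close> fy by (simp add: gap_def field_simps)
  define \<epsilon> where "\<epsilon> = gap / (2 * (D * T + 1))"
  have DT: "0 \<le> D * T" using T D by simp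
  then have "\<epsilon> > 0" using gap by (simp add: \<epsilon>_def)
  moreover have "open {c'<..} \<and> r \<in> {c'<..}" using c' by simp
  ultimately obtain m n k where mn: "\<not> (m = 0 \<and> n = 0)" "c' < of_nat m / of_nat n"
    and k: "real k \<le> \<epsilon> * real (max m n)"
    and ineq: "nfold m y + nfold k gm \<le> nfold n x + nfold k gp"
    using r unfolding regularized_rate_def by (metis greaterThan_iff)
  have m_gr: "c * real n < real m"
  proof (cases "n = 0")
    case False
    then show ?thesis using mn(2) c by (simp add: of_nat_divide_ennreal ennreal_less_iff field_simps)
  qed (use mn in simp)
  then have "0 < real m" using \<open>0 < c\<close> by (smt (verit) mult_nonneg_nonneg of_nat_0_le_iff)
  have n_le: "real n \<le> real m / c" using m_gr \<open>0 < c\<close> by (simp add: field_simps)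
  have "real (max m n) \<le> real m * D"
  proof -
    have "real m * 1 \<le> real m * D" "real m * (1 / c) \<le> real m * D"
      unfolding D_def by (intro mult_left_mono; simp)+
    then show ?thesis using n_le by (simp add: max_def)
  qed
  then have k_le: "real k \<le> \<epsilon> * (real m * D)"
    using k \<open>\<epsilon> > 0\<close> by (meson mult_left_mono order_trans less_imp_le)
  have "f (nfold m y + nfold k gm) \<le> f (nfold n x + nfold k gp)"
    using f ineq unfolding functional_def by blast
  then have "real m * f y + real k * f gm \<le> real n * f x + real k * f gp"
    using f functional_nfold[OF f] by (simp add: functional_def)
  then have "real m * f y \<le> real n * f x + real k * T" by (simp add: T_def algebra_simps)
  also have "\<dots> \<le> (real m / c) * f x + (\<epsilon> * (real m * D)) * T"
    by (intro add_mono mult_right_mono n_le k_le fx T)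
  finally have "real m * gap \<le> real m * (\<epsilon> * (D * T))" by (simp add: gap_def algebra_simps)
  then have "gap \<le> \<epsilon> * (D * T)" using \<open>0 < real m\<close> by simp
  also have "\<dots> < \<epsilon> * (2 * (D * T + 1))"
    using \<open>\<epsilon> > 0\<close> DT by (intro mult_strict_left_mono) auto
  also have "\<dots> = gap" using DT by (simp add: \<epsilon>_def)
  finally show False by simp
qed

text \<open>
  Apply the separation theorem to \<open>n x\<close> and \<open>m y\<close>. Passing to \<open>N\<close> copies does not change the
  fraction \<open>m/n\<close>. Functionals with \<open>f y = 0\<close> satisfy \<open>m f y \<le> n f x\<close> because \<open>f x \<ge> 0\<close>.
\<close>

lemma regularized_rate_of_extremal_bound:
  assumes gen: "generating_pair gp gm" and x: "0 \<le> x" and y: "0 \<le> y" and "n > 0"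
    and bound: "\<And>f. extremal_functional f \<Longrightarrow> f y \<noteq> 0 \<Longrightarrow> real m / real n \<le> f x / f y"
  shows "regularized_rate gp gm x y (ennreal (real m / real n))"
  unfolding regularized_rate_def
proof (intro allI impI)
  fix \<epsilon> :: real and U :: "ennreal set"
  assume "\<epsilon> > 0" and U: "open U \<and> ennreal (real m / real n) \<in> U"
  have "f (nfold m y) \<le> f (nfold n x)" if ext: "extremal_functional f" for f
  proof -
    have f: "functional f" using ext by (simp add: extremal_functional_def)
    note fx = functional_nonneg[OF f x] and fy = functional_nonneg[OF f y]
    have "real m * f y \<le> real n * f x"
    proof (cases "f y = 0")
      case False
      with fy bound[OF ext] \<open>n > 0\<close> show ?thesis by (simp add: field_simps)
    qed (use fx in simp)
    then show ?thesis by (simp add: functional_nfold[OF f])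
  qed
  from extremal_functionals_detect_order[where a = "nfold n x" and b = "nfold m y", OF gen this \<open>\<epsilon> > 0\<close>]
  obtain N k where N: "N > 0" "real k \<le> \<epsilon> * real N"
    and ineq: "nfold N (nfold m y) + nfold k gm \<le> nfold N (nfold n x) + nfold k gp" by auto
  have "(of_nat (N * m) / of_nat (N * n) :: ennreal) = ennreal (real m / real n)"
    using N \<open>n > 0\<close> by (subst of_nat_divide_ennreal) simp_all
  moreover have "real k \<le> \<epsilon> * real (max (N * m) (N * n))"
  proof -
    have "N \<le> max (N * m) (N * n)" using \<open>n > 0\<close> by (simp add: le_max_iff_disj)
    then have "\<epsilon> * real N \<le> \<epsilon> * real (max (N * m) (N * n))"
      using \<open>\<epsilon> > 0\<close> by (intro mult_left_mono) (simp_all only: of_nat_le_iff less_imp_le)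
    with N show ?thesis by linarith
  qed
  moreover have "\<not> (N * m = 0 \<and> N * n = 0)" using N \<open>n > 0\<close> by simp
  ultimately show "\<exists>m n k. \<not> (m = 0 \<and> n = 0) \<and> of_nat m / of_nat n \<in> U \<and>
      real k \<le> \<epsilon> * real (max m n) \<and> nfold m y + nfold k gm \<le> nfold n x + nfold k gp"
    using U ineq unfolding nfold_nfold by metis
qed

lemma ennreal_fraction_between:
  assumes "c < (d::ennreal)"
  obtains m n :: nat where "n > 0" "c < ennreal (real m / real n)" "ennreal (real m / real n) < d"
proof -
  from dense[OF assms] obtain e where e: "c < e" "e < d" by blast
  obtain c' where c': "c = ennreal c'" "0 \<le> c'"
    using assms by (cases c) auto
  obtain e' where e': "e = ennreal e'" "0 \<le> e'"
    using e by (cases e) auto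
  have "c' < e'" using e c' e' by (simp add: ennreal_less_iff)
  then obtain t where t: "t \<in> \<rat>" "c' < t" "t < e'" using Rats_dense_in_real by blast
  then obtain m n :: nat where mn: "n \<noteq> 0" "\<bar>t\<bar> = real m / real n"
    by (metis Rats_abs_nat_div_natE)
  then have "t = real m / real n" using t c' by simp
  show thesis
  proof (rule that)
    show "n > 0" using mn by simp
    show "c < ennreal (real m / real n)"
      using t c' by (simp add: ennreal_less_iff flip: \<open>t = real m / real n\<close>)
    have "ennreal (real m / real n) < e"
      using t c' e' by (simp add: ennreal_less_iff flip: \<open>t = real m / real n\<close>)
    then show "ennreal (real m / real n) < d" using e by simp
  qed
qed

theorem theorem8p24:
  fixes gp gm x y :: "'a::ordered_comm_monoid_add"
  assumes "generating_pair gp gm"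
    and "x \<ge> 0" and "y \<ge> 0"
  shows "R_reg_min gp gm x y = 0
    \<and> R_reg_max gp gm x y =
        (INF f \<in> {f :: 'a \<Rightarrow> real. functional f \<and> f y \<noteq> 0}. ennreal (f x / f y))
    \<and> R_reg_max gp gm x y =
        (INF f \<in> {f :: 'a \<Rightarrow> real. extremal_functional f \<and> f y \<noteq> 0}. ennreal (f x / f y))"
proof -
  let ?all = "INF f \<in> {f :: 'a \<Rightarrow> real. functional f \<and> f y \<noteq> 0}. ennreal (f x / f y)"
  let ?ext = "INF f \<in> {f :: 'a \<Rightarrow> real. extremal_functional f \<and> f y \<noteq> 0}. ennreal (f x / f y)"
  have "R_reg_min gp gm x y \<le> 0"
    unfolding R_reg_min_def using regularized_rate_zero[OF assms(2)] by (intro Inf_lower) simp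
  then have min: "R_reg_min gp gm x y = 0" by simp
  have upper: "R_reg_max gp gm x y \<le> ?all"
    unfolding R_reg_max_def
    by (intro Sup_least INF_greatest) (simp add: regularized_rate_le_ratio[OF assms])
  have sub: "?all \<le> ?ext"
    by (intro INF_superset_mono) (auto simp: extremal_functional_def)
  have lower: "?ext \<le> R_reg_max gp gm x y"
  proof (rule dense_le)
    fix c assume "c < ?ext"
    then obtain m n :: nat where mn: "n > 0" "c < ennreal (real m / real n)"
      "ennreal (real m / real n) < ?ext" by (rule ennreal_fraction_between)
    have "regularized_rate gp gm x y (ennreal (real m / real n))"
    proof (rule regularized_rate_of_extremal_bound[OF assms mn(1)])
      fix f :: "'a \<Rightarrow> real" assume f: "extremal_functional f" "f y \<noteq> 0"
      then have "?ext \<le> ennreal (f x / f y)" by (intro INF_lower) simp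
      with mn(3) have "ennreal (real m / real n) < ennreal (f x / f y)" by (rule less_le_trans)
      then show "real m / real n \<le> f x / f y" by (simp add: ennreal_less_iff)
    qed
    then have "ennreal (real m / real n) \<le> R_reg_max gp gm x y"
      unfolding R_reg_max_def by (intro Sup_upper) simp
    with mn(2) show "c \<le> R_reg_max gp gm x y" by simp
  qed
  have "R_reg_max gp gm x y = ?all" by (rule antisym[OF upper order_trans[OF sub lower]])
  moreover have "R_reg_max gp gm x y = ?ext"
    by (rule antisym[OF order_trans[OF upper sub] lower])
  ultimately show ?thesis using min by blast
qed

end
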